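(* Let $G$ be an $(R,\leq,\preceq)$-partially ordered module with an analytic topological structure $\ll$, let $(X,d)$ be a complete metric space valued in the partially ordered module $G$, and let $T: X\to 2^X\setminus\{\emptyset\}$ be a multi-valued mapping. Let $\alpha: X\times X\to[0,1)=\{r\in R: 0\le r<1\}$ be a mapping satisfying: for any two sequences $\{x_n\}$ and $\{y_n\}$ of $X$ with $[1-\alpha(x_n,y_n)]d(x_n,y_n)\to\theta$, there is an element $\alpha\in[0,1)$ such that $\alpha(x_n,y_n)\le\alpha$ for all $n\in\mathbb N$, $1-\alpha$ has a multiplicative inverse $(1-\alpha)^{-1}$ in $R$, and $(1-\alpha)^{-1}>0$. Then: (i) Suppose that for all $x\ne y$ in $X$ and all $x'\in Tx$ there exists $\bar y\in Ty$ such that $d(x',\bar y)\preceq\alpha(x,y)d(x,y)$. Then $T$ has a unique endpoint if and only if $T$ has the approximate endpoint property. (ii) Let $(X,d)$ be regular. Suppose that for all $x\neq y$ in $X$ we have $d(x',y')\preceq\alpha(x,y)d(x,y)$ for all $x'\in Tx$ and all $y'\in Ty$. Then $T$ has a unique endpoint.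
   Context: Partially ordered group: an abelian group $G$ (written additively, identity $\theta$) with a partial order $\preceq$ such that $a\prec b\Rightarrow a+c\prec b+c$ for all $a,b,c\in G$, where $a\prec b$ means $a\preceq b$ and $a\ne b$. Put $G_+=\{a\in G: a\succeq\theta\}$. $(R,\leq,\preceq)$-partially ordered module: a $\preceq$-partially ordered group $G$ (having non-identity elements) which is a module over an integral ring (integral domain) $R$ with unit $1$ and zero $0$, where the additive group of $R$ is a partially ordered group under a partial order $\le$ (with strict part $<$), such that $1>0$, and $a\prec b\Rightarrow ra\prec rb$ for all $a,b\in G$ and all $r\in R$ with $r>0$. Analytic topological structure of a partially ordered module $G$: a non-empty binary relation $\ll$ on $G$ such that, for all $a,b,c\in G$: (t1) $a\ll b\Rightarrow a\prec b$; (t2) $a\preceq b$ and $b\ll c$ imply $a\ll c$; (t3) $a\ll b\Rightarrow a+c\ll b+c$; (t4) if $\theta\preceq a$ and $a\ll\varepsilon$ for all $\varepsilon\gg\theta$, then $a=\theta$; (t5) for every $\varepsilon\gg\theta$ there is $\eta\gg\theta$ with $\eta\ll\varepsilon$; (t6) $a\ll b\Rightarrow ra\ll rb$ for all $r\in R$ with $r>0$. Convergence in $G_+$: a sequence $\{a_n\}$ in $G_+$ converges to $a\in G_+$ ($a_n\to a$) if for every $\varepsilon\gg\theta$ there is a natural number $N$ with $\theta\preceq a_n-a\ll\varepsilon$ for all $n>N$. $G$ is regular if every decreasing sequence in $G_+$ (i.e. $a_{n+1}\preceq a_n$ for all $n$) converges to some $a\in G_+$. Metric space valued in $G$: a non-empty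 set $X$ with a map $d:X\times X\to G$ such that $d(x,y)\succeq\theta$, with $d(x,y)=\theta$ iff $x=y$; $d(x,y)=d(y,x)$; and $d(x,y)\preceq d(x,z)+d(z,y)$ for all $x,y,z\in X$. A sequence $\{x_n\}$ in $X$ converges to $x\in X$ if $d(x_n,x)\to\theta$; it is Cauchy if for every $\varepsilon\gg\theta$ there is $N$ with $d(x_n,x_m)\ll\varepsilon$ for all $n,m\ge N$; $(X,d)$ is complete if every Cauchy sequence converges, and regular if $G$ is regular. An endpoint of $T$ is a point $x\in X$ with $Tx=\{x\}$. $T$ has the approximate endpoint property if there exist a sequence $\{x_n\}$ in $X$ and a sequence $\{a_n\}$ in $G_+$ with $a_n\to\theta$ such that $d(x_n,x_n')\preceq a_n$ for all $x_n'\in Tx_n$ and all $n\in\mathbb N$. *)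

theory Defs
  imports Complex_Main "HOL-Library.FuncSet"
begin

text \<open>
  The orders \<open>\<le>\<close> on the ring \<open>'r\<close> and \<open>\<preceq>\<close> on the group \<open>'g\<close> are both rendered by the class
  \<open>ordered_ab_group_add\<close>. No compatibility between the order and the multiplication
  of \<open>'r\<close> is assumed beyond \<open>0 < 1\<close>.
\<close>

locale partially_ordered_module = module scale
  for scale :: "'r::{idom, ordered_ab_group_add} \<Rightarrow> 'g::ordered_ab_group_add \<Rightarrow> 'g" +
  assumes nontrivial: "\<exists>g::'g. g \<noteq> 0"
    and one_pos: "(0::'r) < 1"
    and scale_strict_mono: "0 < r \<Longrightarrow> a < b \<Longrightarrow> scale r a < scale r b"

locale analytic_po_module = partially_ordered_module scale
  for scale :: "'r::{idom, ordered_ab_group_add} \<Rightarrow> 'g::ordered_ab_group_add \<Rightarrow> 'g" +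
  fixes ll :: "'g \<Rightarrow> 'g \<Rightarrow> bool" (infix \<open>\<lless>\<close> 50)
  assumes nonempty: "\<exists>a b. a \<lless> b"
    and t1: "a \<lless> b \<Longrightarrow> a < b"
    and t2: "a \<le> b \<Longrightarrow> b \<lless> c \<Longrightarrow> a \<lless> c"
    and t3: "a \<lless> b \<Longrightarrow> a + c \<lless> b + c"
    and t4: "0 \<le> a \<Longrightarrow> (\<And>e. 0 \<lless> e \<Longrightarrow> a \<lless> e) \<Longrightarrow> a = 0"
    and t5: "0 \<lless> e \<Longrightarrow> \<exists>h. 0 \<lless> h \<and> h \<lless> e"
    and t6: "0 < r \<Longrightarrow> a \<lless> b \<Longrightarrow> scale r a \<lless> scale r b"

text \<open>Convergence is a notion of the positive cone: the sequence and its limit are required to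
  be nonnegative, and the sequence approaches the limit from above.\<close>

definition converges_to ::
  "('g::ordered_ab_group_add \<Rightarrow> 'g \<Rightarrow> bool) \<Rightarrow> (nat \<Rightarrow> 'g) \<Rightarrow> 'g \<Rightarrow> bool" where
  "converges_to ll u a \<longleftrightarrow> (\<forall>n. 0 \<le> u n) \<and> 0 \<le> a \<and>
     (\<forall>e. ll 0 e \<longrightarrow> (\<exists>N. \<forall>n>N. 0 \<le> u n - a \<and> ll (u n - a) e))"

definition regular :: "('g::ordered_ab_group_add \<Rightarrow> 'g \<Rightarrow> bool) \<Rightarrow> bool" where
  "regular ll \<longleftrightarrow>
     (\<forall>u::nat \<Rightarrow> 'g. (\<forall>n. 0 \<le> u n) \<and> (\<forall>n. u (Suc n) \<le> u n) \<longrightarrow> (\<exists>a. converges_to ll u a))"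

locale valued_metric_space =
  fixes X :: "'x set" and d :: "'x \<Rightarrow> 'x \<Rightarrow> 'g::ordered_ab_group_add"
  assumes carrier_nonempty: "X \<noteq> {}"
    and dist_nonneg: "x \<in> X \<Longrightarrow> y \<in> X \<Longrightarrow> 0 \<le> d x y"
    and dist_eq_0_iff: "x \<in> X \<Longrightarrow> y \<in> X \<Longrightarrow> d x y = 0 \<longleftrightarrow> x = y"
    and dist_sym: "x \<in> X \<Longrightarrow> y \<in> X \<Longrightarrow> d x y = d y x"
    and dist_triangle: "x \<in> X \<Longrightarrow> y \<in> X \<Longrightarrow> z \<in> X \<Longrightarrow> d x y \<le> d x z + d z y"

definition valued_cauchy ::
  "('g::ordered_ab_group_add \<Rightarrow> 'g \<Rightarrow> bool) \<Rightarrow> ('x \<Rightarrow> 'x \<Rightarrow> 'g) \<Rightarrow> (nat \<Rightarrow> 'x) \<Rightarrow> bool" where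
  "valued_cauchy ll d s \<longleftrightarrow> (\<forall>e. ll 0 e \<longrightarrow> (\<exists>N. \<forall>n\<ge>N. \<forall>m\<ge>N. ll (d (s n) (s m)) e))"

definition valued_complete ::
  "('g::ordered_ab_group_add \<Rightarrow> 'g \<Rightarrow> bool) \<Rightarrow> 'x set \<Rightarrow> ('x \<Rightarrow> 'x \<Rightarrow> 'g) \<Rightarrow> bool" where
  "valued_complete ll X d \<longleftrightarrow>
     (\<forall>s::nat \<Rightarrow> 'x. range s \<subseteq> X \<and> valued_cauchy ll d s \<longrightarrow>
        (\<exists>x\<in>X. converges_to ll (\<lambda>n. d (s n) x) 0))"

definition is_endpoint :: "'x set \<Rightarrow> ('x \<Rightarrow> 'x set) \<Rightarrow> 'x \<Rightarrow> bool" where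
  "is_endpoint X T x \<longleftrightarrow> x \<in> X \<and> T x = {x}"

definition approx_endpoint_property ::
  "('g::ordered_ab_group_add \<Rightarrow> 'g \<Rightarrow> bool) \<Rightarrow> 'x set \<Rightarrow> ('x \<Rightarrow> 'x \<Rightarrow> 'g) \<Rightarrow> ('x \<Rightarrow> 'x set) \<Rightarrow> bool"
  where
  "approx_endpoint_property ll X d T \<longleftrightarrow>
     (\<exists>(s::nat \<Rightarrow> 'x) (a::nat \<Rightarrow> 'g). range s \<subseteq> X \<and> converges_to ll a 0 \<and>
        (\<forall>n. \<forall>x'\<in>T (s n). d (s n) x' \<le> a n))"

end

theory Submission
  imports Defs
begin

text \<open>
  If \<open>x \<noteq> y\<close> are approximate endpoints with errors \<open>a\<close> and \<open>b\<close>, the triangle inequality through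
  \<open>T x\<close> and \<open>T y\<close> gives \<open>(1 - \<alpha> x y) d x y \<le> a + b\<close>. Along two sequences of approximate endpoints
  with vanishing errors, the hypothesis on \<open>\<alpha>\<close> therefore provides a uniform invertible \<open>1 - A\<close> and
  forces the distances to vanish: approximate endpoints form a Cauchy sequence, whose limit is an
  endpoint. In the regular case, an orbit \<open>x (n + 1) \<in> T (x n)\<close> that never stays in place has
  decreasing steps \<open>d (x n) (x (n + 1))\<close>, so \<open>(1 - \<alpha>) d\<close>, being at most the difference of two
  consecutive steps, tends to 0. Hence the steps tend to 0, and they bound the distances from
  \<open>x (n + 1)\<close> to \<open>T (x (n + 1))\<close>.
\<close>

section \<open>Scalar multiplication and the two orders\<close>

context partially_ordered_module
begin

lemma scale_nonneg: "0 \<le> r \<Longrightarrow> 0 \<le> a \<Longrightarrow> 0 \<le> scale r a"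
  using scale_strict_mono[of r 0 a] by (cases "r = 0"; cases "a = 0") (auto simp: less_le)

lemma scale_right_mono:
  assumes "0 \<le> r" "a \<le> b"
  shows "scale r a \<le> scale r b"
  using scale_nonneg[of r "b - a"] assms by (simp add: scale_right_diff_distrib)

text \<open>Reduces to \<open>scale_nonneg\<close> for the scalar \<open>s - r\<close>, so that only
  the additive order of the ring enters.\<close>

lemma scale_left_mono:
  assumes "r \<le> s" "0 \<le> a"
  shows "scale r a \<le> scale s a"
  using scale_nonneg[of "s - r" a] assms by (simp add: scale_left_diff_distrib)

lemma scale_le_self:
  assumes "r \<le> 1" "0 \<le> a"
  shows "scale r a \<le> a"
  using scale_left_mono[OF assms] by simp

text \<open>A positive \<open>a\<close> would make \<open>(1 - r) a\<close> positive, against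
  \<open>a \<le> r a\<close>.\<close>

lemma le_scale_imp_eq_0:
  assumes "r < 1" "0 \<le> a" "a \<le> scale r a"
  shows "a = 0"
proof (rule ccontr)
  assume "a \<noteq> 0"
  then have "scale (1 - r) 0 < scale (1 - r) a"
    using assms by (intro scale_strict_mono) (auto simp: less_le)
  then show False
    using assms(3) by (simp add: scale_left_diff_distrib leD)
qed

end

section \<open>Sequences tending to 0\<close>

context analytic_po_module
begin

text \<open>Guarantees that the quantifier over \<open>e\<close> in \<open>converges_to\<close> is
  not vacuous.\<close>

lemma ex_pos: "\<exists>e. 0 \<lless> e"
proof -
  obtain a b where "a \<lless> b"
    using nonempty by blast
  then show ?thesis
    using t3[of a b "- a"] by auto
qed

lemma converges_to_0_iff:
  "converges_to ll u 0 \<longleftrightarrow> (\<forall>n. 0 \<le> u n) \<and> (\<forall>e. 0 \<lless> e \<longrightarrow> (\<exists>N. \<forall>n>N. u n \<lless> e))"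
  by (auto simp: converges_to_def)

lemma converges_to_0_le:
  assumes "converges_to ll u 0" "\<And>n. 0 \<le> w n" "\<And>n. w n \<le> u n"
  shows "converges_to ll w 0"
  using assms by (meson converges_to_0_iff t2)

text \<open>Halving \<open>e\<close> is not possible in general; instead \<open>t5\<close> splits it
  as \<open>h + (e - h)\<close> with both parts above 0.\<close>

lemma converges_to_0_add:
  assumes u: "converges_to ll u 0" and w: "converges_to ll w 0"
  shows "converges_to ll (\<lambda>n. u n + w n) 0"
  unfolding converges_to_0_iff
proof (intro conjI allI impI)
  show "0 \<le> u n + w n" for n
    using u w by (simp add: converges_to_0_iff)
  fix e assume "0 \<lless> e"
  then obtain h where h: "0 \<lless> h" "h \<lless> e"
    using t5 by blast
  then have "0 \<lless> e - h"
    using t3[of h e "- h"] by simp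
  then obtain M N where MN: "\<And>n. n > M \<Longrightarrow> u n \<lless> h" "\<And>n. n > N \<Longrightarrow> w n \<lless> e - h"
    using u w h(1) by (meson converges_to_0_iff)
  \<comment> \<open>One of the two estimates is weakened to \<le> by \<open>t1\<close>, because
    \<open>t2\<close> chains \<le> with \<lless>.\<close>
  have "u n + w n \<lless> e" if "n > max M N" for n
  proof (rule t2)
    show "u n + w n \<le> h + w n"
      using t1[OF MN(1)[of n]] that by (simp add: less_imp_le)
    show "h + w n \<lless> e"
      using t3[OF MN(2)[of n], of h] that by (simp add: add.commute)
  qed
  then show "\<exists>N. \<forall>n>N. u n + w n \<lless> e"
    by blast
qed

lemma converges_to_0_subseq:
  assumes "converges_to ll u 0" "\<And>k. k \<le> f k"
  shows "converges_to ll (\<lambda>k. u (f k)) 0"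
  using assms by (meson converges_to_0_iff less_le_trans)

text \<open>The threshold \<open>e\<close> is tested as \<open>r e\<close>, and \<open>t6\<close> is
  used twice: with \<open>r\<close> to pass to \<open>r e\<close>, with the inverse \<open>v\<close>
  to return.\<close>

lemma converges_to_0_scale_cancel:
  assumes "converges_to ll (\<lambda>n. scale r (u n)) 0" "r > 0" "r * v = 1" "v > 0" "\<And>n. 0 \<le> u n"
  shows "converges_to ll u 0"
  unfolding converges_to_0_iff
proof (intro conjI allI impI)
  show "0 \<le> u n" for n
    by fact
  fix e assume "0 \<lless> e"
  then have "0 \<lless> scale r e"
    using t6[OF \<open>r > 0\<close>, of 0 e] by simp
  then obtain N where N: "\<And>n. n > N \<Longrightarrow> scale r (u n) \<lless> scale r e"
    using assms(1) unfolding converges_to_0_iff by blast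
  have "u n \<lless> e" if "n > N" for n
    using t6[OF \<open>v > 0\<close> N[OF that]] \<open>r * v = 1\<close> by (simp add: mult.commute)
  then show "\<exists>N. \<forall>n>N. u n \<lless> e"
    by blast
qed

lemma eq_0_if_le_converges_to_0:
  assumes "converges_to ll u 0" "0 \<le> a" "\<And>n. a \<le> u n"
  shows "a = 0"
  using assms by (intro t4) (meson converges_to_0_iff lessI t2)+

end

section \<open>The common hypotheses of both parts of the theorem\<close>

locale endpoint_problem =
  analytic_po_module scale ll + valued_metric_space X d
  for scale :: "'r::{idom, ordered_ab_group_add} \<Rightarrow> 'g::ordered_ab_group_add \<Rightarrow> 'g"
    and ll :: "'g \<Rightarrow> 'g \<Rightarrow> bool" (infix \<open>\<lless>\<close> 50)
    and X :: "'x set"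
    and d :: "'x \<Rightarrow> 'x \<Rightarrow> 'g" +
  fixes T :: "'x \<Rightarrow> 'x set"
    and \<alpha> :: "'x \<Rightarrow> 'x \<Rightarrow> 'r"
  assumes complete: "valued_complete ll X d"
    and T_maps: "T \<in> X \<rightarrow> Pow X - {{}}"
    and \<alpha>_range: "x \<in> X \<Longrightarrow> y \<in> X \<Longrightarrow> 0 \<le> \<alpha> x y \<and> \<alpha> x y < 1"
    and \<alpha>_bounded: "range s \<subseteq> X \<Longrightarrow> range t \<subseteq> X \<Longrightarrow>
           converges_to ll (\<lambda>n. scale (1 - \<alpha> (s n) (t n)) (d (s n) (t n))) 0 \<Longrightarrow>
           \<exists>A::'r. 0 \<le> A \<and> A < 1 \<and> (\<forall>n. \<alpha> (s n) (t n) \<le> A) \<and>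
             (\<exists>v. (1 - A) * v = 1 \<and> 0 < v)"
begin

lemma T_subset: "x \<in> X \<Longrightarrow> y \<in> T x \<Longrightarrow> y \<in> X"
  and T_nonempty: "x \<in> X \<Longrightarrow> \<exists>y. y \<in> T x"
  using T_maps by auto

lemma dist_self: "x \<in> X \<Longrightarrow> d x x = 0"
  by (simp add: dist_eq_0_iff)

lemma scaled_dist_le: "x \<in> X \<Longrightarrow> y \<in> X \<Longrightarrow> scale (\<alpha> x y) (d x y) \<le> d x y"
  by (simp add: scale_le_self \<alpha>_range dist_nonneg less_imp_le)

text \<open>The single point where \<open>\<alpha>_bounded\<close> is applied. Squeezing provides
  its premise; the uniform bound \<open>A\<close> then replaces the varying factors by the constant
  \<open>1 - A\<close>, which can be cancelled.\<close>

lemma dist_converges_to_0: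
  assumes st: "range s \<subseteq> X" "range t \<subseteq> X"
    and b: "converges_to ll b 0"
    and le: "\<And>n. scale (1 - \<alpha> (s n) (t n)) (d (s n) (t n)) \<le> b n"
  shows "converges_to ll (\<lambda>n. d (s n) (t n)) 0"
proof -
  have X: "s n \<in> X" "t n \<in> X" for n
    using st by auto
  let ?c = "\<lambda>n. scale (1 - \<alpha> (s n) (t n)) (d (s n) (t n))"
  have "converges_to ll ?c 0"
    using b le X by (intro converges_to_0_le[OF b]) (auto intro!: scale_nonneg
        simp: dist_nonneg \<alpha>_range less_imp_le)
  moreover obtain A v where A: "A < 1" "\<And>n. \<alpha> (s n) (t n) \<le> A" "(1 - A) * v = 1" "0 < v"
    using \<alpha>_bounded[OF st calculation] by blast
  ultimately have "converges_to ll (\<lambda>n. scale (1 - A) (d (s n) (t n))) 0"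
    using X by (elim converges_to_0_le) (auto intro!: scale_nonneg scale_left_mono
        simp: dist_nonneg less_imp_le diff_left_mono)
  then show ?thesis
    using A X by (elim converges_to_0_scale_cancel) (auto simp: dist_nonneg)
qed

lemma endpoint_imp_approx_endpoint:
  assumes "is_endpoint X T x"
  shows "approx_endpoint_property ll X d T"
  unfolding approx_endpoint_property_def
  using assms
  by (intro exI[of _ "\<lambda>_. x"] exI[of _ "\<lambda>_. 0"])
    (auto simp: is_endpoint_def converges_to_0_iff dist_self)

section \<open>Part (i): the contraction with a chosen image point\<close>

context
  assumes contraction: "x \<in> X \<Longrightarrow> y \<in> X \<Longrightarrow> x \<noteq> y \<Longrightarrow> x' \<in> T x \<Longrightarrow>
    \<exists>y'\<in>T y. d x' y' \<le> scale (\<alpha> x y) (d x y)"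
begin

text \<open>For \<open>x = y\<close> the witness is \<open>x'\<close> itself and both sides vanish,
  so later estimates need no case distinction.\<close>

lemma contraction':
  assumes "x \<in> X" "y \<in> X" "x' \<in> T x"
  shows "\<exists>y'\<in>T y. d x' y' \<le> scale (\<alpha> x y) (d x y)"
proof (cases "x = y")
  case True
  then show ?thesis
    using assms by (intro bexI[of _ x']) (auto simp: dist_self T_subset)
qed (use contraction assms in blast)

lemma endpoint_unique:
  assumes "is_endpoint X T x" "is_endpoint X T y"
  shows "x = y"
proof -
  have X: "x \<in> X" "y \<in> X" and "T x = {x}" "T y = {y}"
    using assms by (auto simp: is_endpoint_def)
  then have "d x y \<le> scale (\<alpha> x y) (d x y)"
    using contraction'[of x y x] by auto
  then have "d x y = 0"
    using X by (intro le_scale_imp_eq_0[of "\<alpha> x y"]) (auto simp: \<alpha>_range dist_nonneg)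
  then show ?thesis
    using X by (simp add: dist_eq_0_iff)
qed

text \<open>The path runs through \<open>x\<close>, \<open>x'\<close>, \<open>y'\<close>,
  \<open>y\<close>; the middle term is then moved to the left-hand side.\<close>

lemma approx_endpoints_dist_le:
  assumes X: "x \<in> X" "y \<in> X"
    and a: "\<And>x'. x' \<in> T x \<Longrightarrow> d x x' \<le> a" and b: "\<And>y'. y' \<in> T y \<Longrightarrow> d y y' \<le> b"
  shows "scale (1 - \<alpha> x y) (d x y) \<le> a + b"
proof -
  obtain x' where x': "x' \<in> T x"
    using T_nonempty X by blast
  then obtain y' where y': "y' \<in> T y" "d x' y' \<le> scale (\<alpha> x y) (d x y)"
    using contraction' X by blast
  have X': "x' \<in> X" "y' \<in> X"
    using T_subset X x' y' by blast+
  have "d x y \<le> d x x' + d x' y"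
    using X X' by (intro dist_triangle)
  also have "d x' y \<le> d x' y' + d y y'"
    using dist_triangle[of x' y y'] dist_sym[of y y'] X X' by simp
  also have "d x x' + (d x' y' + d y y') \<le> a + (scale (\<alpha> x y) (d x y) + b)"
    using a b x' y' by (intro add_mono) auto
  finally have "d x y \<le> a + (scale (\<alpha> x y) (d x y) + b)"
    by (simp add: add_left_mono)
  then show ?thesis
    by (simp add: scale_left_diff_distrib algebra_simps)
qed

text \<open>The condition on \<alpha> concerns pairs of sequences with a common index. A failure of
  the Cauchy property is therefore turned into two sequences \<open>s (f k)\<close> and
  \<open>s (g k)\<close> whose distances stay out of reach of a fixed \<open>e\<close>.\<close>

lemma approx_endpoint_sequence_cauchy:
  assumes s: "range s \<subseteq> X" and a: "converges_to ll a 0"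
    and le: "\<And>n x'. x' \<in> T (s n) \<Longrightarrow> d (s n) x' \<le> a n"
  shows "valued_cauchy ll d s"
proof (rule ccontr)
  assume "\<not> valued_cauchy ll d s"
  then obtain e where e: "0 \<lless> e" "\<And>N. \<exists>n\<ge>N. \<exists>m\<ge>N. \<not> d (s n) (s m) \<lless> e"
    unfolding valued_cauchy_def by blast
  obtain f where f: "\<And>k. k \<le> f k" "\<And>k. \<exists>m\<ge>k. \<not> d (s (f k)) (s m) \<lless> e"
    using choice[of "\<lambda>k n. k \<le> n \<and> (\<exists>m\<ge>k. \<not> d (s n) (s m) \<lless> e)"] e(2) by blast
  obtain g where g: "\<And>k. k \<le> g k" "\<And>k. \<not> d (s (f k)) (s (g k)) \<lless> e"
    using choice[of "\<lambda>k m. k \<le> m \<and> \<not> d (s (f k)) (s m) \<lless> e"] f(2) by blast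
  have "converges_to ll (\<lambda>k. a (f k) + a (g k)) 0"
    by (intro converges_to_0_add converges_to_0_subseq[OF a] f(1) g(1))
  then have "converges_to ll (\<lambda>k. d (s (f k)) (s (g k))) 0"
  proof (rule dist_converges_to_0[rotated 2])
    show "scale (1 - \<alpha> (s (f k)) (s (g k))) (d (s (f k)) (s (g k))) \<le> a (f k) + a (g k)" for k
      using s le by (intro approx_endpoints_dist_le) auto
  qed (use s in auto)
  then show False
    using e(1) g(2) by (meson converges_to_0_iff lessI)
qed

lemma approx_endpoint_imp_endpoint:
  assumes "approx_endpoint_property ll X d T"
  shows "\<exists>x. is_endpoint X T x"
proof -
  obtain s a where s: "range s \<subseteq> X" and a: "converges_to ll a 0"
    and le: "\<And>n x'. x' \<in> T (s n) \<Longrightarrow> d (s n) x' \<le> a n"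
    using assms unfolding approx_endpoint_property_def by blast
  have sX: "s n \<in> X" for n
    using s by auto
  obtain x where x: "x \<in> X" and lim: "converges_to ll (\<lambda>n. d (s n) x) 0"
    using complete s approx_endpoint_sequence_cauchy[OF s a le]
    unfolding valued_complete_def by blast
  have "x' = x" if x': "x' \<in> T x" for x'
  proof -
    have x'X: "x' \<in> X"
      using T_subset x x' by blast
    \<comment> \<open>The path runs through \<open>x\<close>, \<open>s n\<close>, \<open>y\<close>,
      \<open>x'\<close>, where the contraction supplies a point \<open>y\<close> of
      \<open>T (s n)\<close> close to \<open>x'\<close>. The right-hand side tends to 0 while the
      left-hand side is constant.\<close>
    have "d x x' \<le> d (s n) x + (a n + d (s n) x)" for n
    proof -
      obtain y where y: "y \<in> T (s n)" "d x' y \<le> scale (\<alpha> x (s n)) (d x (s n))"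
        using contraction'[OF x sX x'] by blast
      have yX: "y \<in> X"
        using T_subset[OF sX y(1)] .
      have "d x x' \<le> d x (s n) + d (s n) x'"
        using x x'X sX by (intro dist_triangle)
      also have "d (s n) x' \<le> d (s n) y + d y x'"
        using x'X yX sX by (intro dist_triangle)
      also have "d y x' \<le> d x (s n)"
        using y(2) scaled_dist_le[OF x sX, of n] dist_sym[OF yX x'X] by simp
      also have "d (s n) y \<le> a n"
        using le y(1) .
      finally show ?thesis
        using dist_sym[OF x sX] by (simp add: add_left_mono add_right_mono)
    qed
    then have "d x x' = 0"
      using x x'X
      by (intro eq_0_if_le_converges_to_0[OF
            converges_to_0_add[OF lim converges_to_0_add[OF a lim]]])
        (auto simp: dist_nonneg)
    then show ?thesis
      using x x'X by (simp add: dist_eq_0_iff)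
  qed
  then have "is_endpoint X T x"
    using T_nonempty[OF x] x by (auto simp: is_endpoint_def)
  then show ?thesis ..
qed

lemma unique_endpoint_iff_approx_endpoint:
  "(\<exists>!x. is_endpoint X T x) \<longleftrightarrow> approx_endpoint_property ll X d T"
  using endpoint_unique endpoint_imp_approx_endpoint approx_endpoint_imp_endpoint by blast

end

section \<open>Part (ii): orbits under regularity\<close>

lemma regular_imp_approx_endpoint:
  assumes regular: "regular ll"
    and contraction: "\<And>x y x' y'. x \<in> X \<Longrightarrow> y \<in> X \<Longrightarrow> x \<noteq> y \<Longrightarrow> x' \<in> T x \<Longrightarrow> y' \<in> T y \<Longrightarrow>
      d x' y' \<le> scale (\<alpha> x y) (d x y)"
  shows "approx_endpoint_property ll X d T"
proof (cases "\<exists>x. is_endpoint X T x")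
  case True
  then show ?thesis
    using endpoint_imp_approx_endpoint by blast
next
  case False
  \<comment> \<open>Without endpoints the orbit can be chosen to move at every step, as the
    contraction speaks of distinct points.\<close>
  have step: "\<exists>y. y \<in> X \<and> y \<in> T x \<and> x \<noteq> y" if "x \<in> X" for x
    using False T_nonempty[OF that] T_subset[OF that] that by (auto simp: is_endpoint_def)
  obtain x0 where "x0 \<in> X"
    using carrier_nonempty by blast
  then obtain x where x: "\<And>n. x n \<in> X" "\<And>n. x (Suc n) \<in> T (x n)" "\<And>n. x n \<noteq> x (Suc n)"
    using dependent_nat_choice[of "\<lambda>_ x. x \<in> X" "\<lambda>_ x y. y \<in> T x \<and> x \<noteq> y"] step by blast
  define u where "u n = d (x n) (x (Suc n))" for n
  have u_nonneg: "0 \<le> u n" for n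
    using x by (simp add: u_def dist_nonneg)
  have le_scale: "d (x (Suc n)) x' \<le> scale (\<alpha> (x n) (x (Suc n))) (u n)"
    if "x' \<in> T (x (Suc n))" for n x'
    unfolding u_def using x that by (intro contraction)
  have le_u: "d (x (Suc n)) x' \<le> u n" if "x' \<in> T (x (Suc n))" for n x'
    using le_scale[OF that] scaled_dist_le[OF x(1) x(1), of n "Suc n"]
    unfolding u_def by (rule order_trans)
  have decreasing: "u (Suc n) \<le> u n" for n
    using le_u[OF x(2)] by (simp add: u_def[of "Suc n"])
  obtain a where a: "converges_to ll u a"
    using regular u_nonneg decreasing unfolding regular_def by blast
  \<comment> \<open>Convergence gives the bound only for large indices; monotonicity carries it back
    to all \<open>n\<close>.\<close>
  have a_le: "a \<le> u n" for n
  proof -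
    obtain e where "0 \<lless> e"
      using ex_pos by blast
    then obtain N where "\<And>n. n > N \<Longrightarrow> 0 \<le> u n - a"
      using a unfolding converges_to_def by blast
    then have "a \<le> u (max n (Suc N))"
      by (simp add: less_max_iff_disj)
    also have "\<dots> \<le> u n"
      by (rule lift_Suc_antimono_le[of u]) (auto intro: decreasing)
    finally show ?thesis .
  qed
  have "converges_to ll (\<lambda>n. u n - a) 0"
    using a a_le by (auto simp: converges_to_def)
  then have "converges_to ll (\<lambda>n. d (x n) (x (Suc n))) 0"
  proof (rule dist_converges_to_0[rotated 2])
    fix n
    \<comment> \<open>The limit \<open>a\<close> lies below \<open>u (Suc n)\<close>, which the
      contraction bounds; subtracting from \<open>u n\<close> leaves a right-hand side that tends to
      0.\<close>
    have "a \<le> scale (\<alpha> (x n) (x (Suc n))) (u n)"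
      using order_trans[OF a_le[of "Suc n"]] le_scale[OF x(2)] by (simp add: u_def[of "Suc n"])
    then show "scale (1 - \<alpha> (x n) (x (Suc n))) (d (x n) (x (Suc n))) \<le> u n - a"
      by (simp add: scale_left_diff_distrib u_def diff_left_mono)
  qed (use x in auto)
  then have "converges_to ll u 0"
    by (simp add: u_def[abs_def])
  then show ?thesis
    unfolding approx_endpoint_property_def
    \<comment> \<open>The shift by one is needed because \<open>u n\<close> controls the image of
      \<open>x (Suc n)\<close>.\<close>
    using x(1) le_u by (intro exI[of _ "\<lambda>n. x (Suc n)"] exI[of _ u]) auto
qed

end

theorem theorem4p1:
  fixes scale :: "'r::{idom, ordered_ab_group_add} \<Rightarrow> 'g::ordered_ab_group_add \<Rightarrow> 'g"
    and ll :: "'g \<Rightarrow> 'g \<Rightarrow> bool"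
    and X :: "'x set"
    and d :: "'x \<Rightarrow> 'x \<Rightarrow> 'g"
    and T :: "'x \<Rightarrow> 'x set"
    and \<alpha> :: "'x \<Rightarrow> 'x \<Rightarrow> 'r"
  assumes "analytic_po_module scale ll"
    and "valued_metric_space X d"
    and "valued_complete ll X d"
    and "T \<in> X \<rightarrow> Pow X - {{}}"
    and "\<And>x y. x \<in> X \<Longrightarrow> y \<in> X \<Longrightarrow> 0 \<le> \<alpha> x y \<and> \<alpha> x y < 1"
    and "\<And>s t :: nat \<Rightarrow> 'x. range s \<subseteq> X \<Longrightarrow> range t \<subseteq> X \<Longrightarrow>
           converges_to ll (\<lambda>n. scale (1 - \<alpha> (s n) (t n)) (d (s n) (t n))) 0 \<Longrightarrow>
           \<exists>A::'r. 0 \<le> A \<and> A < 1 \<and> (\<forall>n. \<alpha> (s n) (t n) \<le> A) \<and>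
             (\<exists>v. (1 - A) * v = 1 \<and> 0 < v)"
  shows "((\<forall>x\<in>X. \<forall>y\<in>X. x \<noteq> y \<longrightarrow>
            (\<forall>x'\<in>T x. \<exists>y'\<in>T y. d x' y' \<le> scale (\<alpha> x y) (d x y))) \<longrightarrow>
          ((\<exists>!x. is_endpoint X T x) \<longleftrightarrow> approx_endpoint_property ll X d T)) \<and>
         (regular ll \<longrightarrow>
          (\<forall>x\<in>X. \<forall>y\<in>X. x \<noteq> y \<longrightarrow>
            (\<forall>x'\<in>T x. \<forall>y'\<in>T y. d x' y' \<le> scale (\<alpha> x y) (d x y))) \<longrightarrow>
          (\<exists>!x. is_endpoint X T x))"
proof -
  interpret endpoint_problem scale ll X d T \<alpha>
    by (intro endpoint_problem.intro endpoint_problem_axioms.intro) (fact assms)+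
  show ?thesis
  proof (intro conjI impI)
    assume "\<forall>x\<in>X. \<forall>y\<in>X. x \<noteq> y \<longrightarrow>
      (\<forall>x'\<in>T x. \<exists>y'\<in>T y. d x' y' \<le> scale (\<alpha> x y) (d x y))"
    then show "(\<exists>!x. is_endpoint X T x) \<longleftrightarrow> approx_endpoint_property ll X d T"
      by (intro unique_endpoint_iff_approx_endpoint) blast
  next
    assume "regular ll" and *: "\<forall>x\<in>X. \<forall>y\<in>X. x \<noteq> y \<longrightarrow>
      (\<forall>x'\<in>T x. \<forall>y'\<in>T y. d x' y' \<le> scale (\<alpha> x y) (d x y))"
    then have "approx_endpoint_property ll X d T"
      by (intro regular_imp_approx_endpoint) blast+
    \<comment> \<open>As images are non-empty, the contraction for all image points implies the one
      of part (i), which then yields existence and uniqueness.\<close>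
    moreover have "\<exists>y'\<in>T y. d x' y' \<le> scale (\<alpha> x y) (d x y)"
      if "x \<in> X" "y \<in> X" "x \<noteq> y" "x' \<in> T x" for x y x'
      using * that T_nonempty[of y] by blast
    ultimately show "\<exists>!x. is_endpoint X T x"
      using unique_endpoint_iff_approx_endpoint by blast
  qed
qed

end
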